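(* Let $d<0$ be a square-free integer such that $\mathcal O_d$ is a principal ideal domain, let $N\ge1$ be an integer, let $\Gamma=\Gamma_N$, and let $\overline X$ be the Baily-Borel compactification of $X=\Gamma\backslash\mathfrak h_2$. If $d\equiv1\pmod4$, assume that $N$ is divisible by 4. If $d=-2$, assume that $N$ is even. If $d=-1$, assume that $N$ is even and $N\ge4$. Then the 1-dimensional boundary strata of $\overline X$ contain no real points, that is, $\overline X(\mathbb R)\cap\partial_1\overline X=\emptyset$.
   Context: Transpose is written ${}^tA$. $\mathcal O_d$ is the ring of integers of $\mathbb Q(\sqrt d)$. If $d\not\equiv1\pmod4$ put $\beta=\begin{pmatrix}0&1\\d&0\end{pmatrix}$; if $d=4m+1$ put $\beta=\begin{pmatrix}1&2\\2m&-1\end{pmatrix}$. Put $N_\beta=\begin{pmatrix}\beta&0\\0&{}^t\beta\end{pmatrix}$. $\mathbf{Sp}(4,\mathbb R)$ consists of real block matrices $\begin{pmatrix}A&B\\C&D\end{pmatrix}$ with ${}^tAD-{}^tCB=I$ and ${}^tAC$, ${}^tBD$ symmetric, acting on the Siegel space $\mathfrak h_2$ (symmetric $2\times2$ complex $Z$ with $\mathrm{Im}\,Z>0$) by $(AZ+B)(CZ+D)^{-1}$. Involutions: $\widehat g=N_\beta gN_\beta^{-1}$ on $\mathbf{Sp}(4,\mathbb R)$ and $\widehat Z=\beta\overline Z\,{}^t\beta^{-1}$ on $\mathfrak h_2$; $\widehat{gZ}=\widehat g\widehat Z$. $\Gamma(N)\subset\mathbf{Sp}(4,\mathbb Z)$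 is the principal congruence subgroup of level $N$ and $\Gamma_N=\Gamma(N)\cap\{\widehat\gamma:\gamma\in\Gamma(N)\}$. $\overline{\mathfrak h}_2$ is the partial Satake compactification of $\mathfrak h_2$ obtained by attaching the rational boundary components of complex dimension 0 and 1 (with the Satake topology); the 1-dimensional ones are the $\mathbf{Sp}(4,\mathbb Z)$-translates of the standard component $F_1\cong\mathfrak h_1$ consisting of the limits $\begin{pmatrix}z&0\\0&i\infty\end{pmatrix}$, $z$ in the upper half plane $\mathfrak h_1$. The Baily-Borel compactification is $\overline X=\Gamma\backslash\overline{\mathfrak h}_2$, with boundary $\overline X-X=\partial_0\overline X\cup\partial_1\overline X$ decomposed into its complex 0- and 1-dimensional strata. The involution $Z\mapsto\widehat Z$ extends to $\overline{\mathfrak h}_2$ and passes to an anti-holomorphic involution of $\overline X$; $\overline X(\mathbb R)$ denotes its fixed point set. *)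

theory Defs
  imports
    "HOL-Analysis.Analysis"
    "HOL-Algebra.Ring_Divisibility"
    "HOL-Computational_Algebra.Squarefree"
begin

section \<open>The ring of integers of an imaginary quadratic field\<close>

definition quadratic_field :: "int \<Rightarrow> complex set" where
  "quadratic_field d = {of_rat a + of_rat b * csqrt (of_int d) | a b. True}"

definition quadratic_integers :: "int \<Rightarrow> complex ring" where
  "quadratic_integers d =
     \<lparr>carrier = {x \<in> quadratic_field d. algebraic_int x},
      mult = (*), one = 1, zero = 0, add = (+)\<rparr>"


section \<open>Block matrices and the symplectic group\<close>

text \<open>A \<open>4 \<times> 4\<close> matrix in \<open>2 \<times> 2\<close> blocks is a matrix indexed by the sum type \<open>2 + 2\<close>.\<close>

type_synonym 'a mat2 = "'a^2^2"
type_synonym 'a mat4 = "'a^(2 + 2)^(2 + 2)"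

definition block :: "'a mat2 \<Rightarrow> 'a mat2 \<Rightarrow> 'a mat2 \<Rightarrow> 'a mat2 \<Rightarrow> 'a mat4" where
  "block A B C D = (\<chi> i j. case i of
       Inl k \<Rightarrow> (case j of Inl l \<Rightarrow> A $ k $ l | Inr l \<Rightarrow> B $ k $ l)
     | Inr k \<Rightarrow> (case j of Inl l \<Rightarrow> C $ k $ l | Inr l \<Rightarrow> D $ k $ l))"

definition ulb :: "'a mat4 \<Rightarrow> 'a mat2" where "ulb g = (\<chi> k l. g $ Inl k $ Inl l)"
definition urb :: "'a mat4 \<Rightarrow> 'a mat2" where "urb g = (\<chi> k l. g $ Inl k $ Inr l)"
definition llb :: "'a mat4 \<Rightarrow> 'a mat2" where "llb g = (\<chi> k l. g $ Inr k $ Inl l)"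
definition lrb :: "'a mat4 \<Rightarrow> 'a mat2" where "lrb g = (\<chi> k l. g $ Inr k $ Inr l)"

definition mat_of_real :: "real^'m^'n \<Rightarrow> complex^'m^'n" where
  "mat_of_real M = (\<chi> i j. of_real (M $ i $ j))"

definition mat_cnj :: "complex^'m^'n \<Rightarrow> complex^'m^'n" where
  "mat_cnj M = (\<chi> i j. cnj (M $ i $ j))"

definition mat_Im :: "complex^'m^'n \<Rightarrow> real^'m^'n" where
  "mat_Im M = (\<chi> i j. Im (M $ i $ j))"

definition vec_cnj :: "complex^'n \<Rightarrow> complex^'n" where
  "vec_cnj v = (\<chi> i. cnj (v $ i))"

definition symmetric_mat :: "'a^'n^'n \<Rightarrow> bool" where
  "symmetric_mat M \<longleftrightarrow> transpose M = M"

definition Sp4R :: "real mat4 set" where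
  "Sp4R = {block A B C D | A B C D.
     transpose A ** D - transpose C ** B = mat 1 \<and>
     symmetric_mat (transpose A ** C) \<and> symmetric_mat (transpose B ** D)}"

definition Sp4Z :: "real mat4 set" where
  "Sp4Z = {g \<in> Sp4R. \<forall>i j. g $ i $ j \<in> \<int>}"

definition Gamma_principal :: "nat \<Rightarrow> real mat4 set" where
  "Gamma_principal N =
     {g \<in> Sp4Z. \<forall>i j. \<exists>k::int. g $ i $ j - mat 1 $ i $ j = of_nat N * of_int k}"


section \<open>The Siegel space\<close>

definition siegel_space :: "complex mat2 set" where
  "siegel_space =
     {Z. symmetric_mat Z \<and> (\<forall>x. x \<noteq> 0 \<longrightarrow> x \<bullet> (mat_Im Z *v x) > 0)}"

definition siegel_act :: "real mat4 \<Rightarrow> complex mat2 \<Rightarrow> complex mat2" where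
  "siegel_act g Z =
     (mat_of_real (ulb g) ** Z + mat_of_real (urb g)) **
     matrix_inv (mat_of_real (llb g) ** Z + mat_of_real (lrb g))"


section \<open>The involutions\<close>

definition beta :: "int \<Rightarrow> real mat2" where
  "beta d = (if d mod 4 = 1
     then vector [vector [1, 2], vector [2 * of_int (d div 4), -1]]
     else vector [vector [0, 1], vector [of_int d, 0]])"

definition N_beta :: "int \<Rightarrow> real mat4" where
  "N_beta d = block (beta d) 0 0 (transpose (beta d))"

definition hat_Sp :: "int \<Rightarrow> real mat4 \<Rightarrow> real mat4" where
  "hat_Sp d g = N_beta d ** g ** matrix_inv (N_beta d)"

definition hat_siegel :: "int \<Rightarrow> complex mat2 \<Rightarrow> complex mat2" where
  "hat_siegel d Z =
     mat_of_real (beta d) ** mat_cnj Z ** matrix_inv (mat_of_real (transpose (beta d)))"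

definition Gamma_hat :: "int \<Rightarrow> nat \<Rightarrow> real mat4 set" where
  "Gamma_hat d N = Gamma_principal N \<inter> hat_Sp d ` Gamma_principal N"


section \<open>The partial Satake compactification\<close>

text \<open>
  The Siegel space together with its rational boundary components is realized inside the
  Grassmannian of Lagrangian planes in \<open>\<complex>\<^sup>4\<close>: a point \<open>Z\<close> of the Siegel space is the column space
  of the \<open>4 \<times> 2\<close> matrix (``frame'') with blocks \<open>Z\<close> and \<open>I\<close>.  In this model the symplectic
  group acts linearly, also on the boundary.  The lemmas at the end check that the model is
  compatible with the action and the involution on the Siegel space.
\<close>

type_synonym plane = "(complex^(2 + 2)) set"
type_synonym frame = "complex^2^(2 + 2)"

definition frame :: "complex mat2 \<Rightarrow> complex mat2 \<Rightarrow> frame" where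
  "frame P Q = (\<chi> i. case i of Inl k \<Rightarrow> P $ k | Inr k \<Rightarrow> Q $ k)"

definition column_space :: "frame \<Rightarrow> plane" where
  "column_space M = range (\<lambda>v. M *v v)"

definition siegel_point :: "complex mat2 \<Rightarrow> plane" where
  "siegel_point Z = column_space (frame Z (mat 1))"

definition diag2 :: "complex \<Rightarrow> complex \<Rightarrow> complex mat2" where
  "diag2 a b = vector [vector [a, 0], vector [0, b]]"

text \<open>
  The column space of the frame of \<open>diag2 z w\<close> is also that of the frame with blocks
  \<open>diag2 z 1\<close> and \<open>diag2 1 (1/w)\<close>; letting \<open>w\<close> tend to \<open>i\<infinity>\<close> gives \<open>F1_point z\<close>.  Likewise \<open>F0_point\<close>
  is the limit of the points \<open>diag2 (i s) (i t)\<close> as \<open>s\<close> and \<open>t\<close> tend to infinity.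
\<close>

definition F1_point :: "complex \<Rightarrow> plane" where
  "F1_point z = column_space (frame (diag2 z 1) (diag2 1 0))"

definition F0_point :: plane where
  "F0_point = column_space (frame (mat 1) 0)"

definition plane_act :: "real mat4 \<Rightarrow> plane \<Rightarrow> plane" where
  "plane_act g L = (\<lambda>v. mat_of_real g *v v) ` L"

definition boundary_components_0 :: "plane set" where
  "boundary_components_0 = {plane_act g F0_point | g. g \<in> Sp4Z}"

definition boundary_components_1 :: "plane set" where
  "boundary_components_1 = {plane_act g (F1_point z) | g z. g \<in> Sp4Z \<and> Im z > 0}"

definition satake_space :: "plane set" where
  "satake_space = siegel_point ` siegel_space \<union> boundary_components_0 \<union> boundary_components_1"

text \<open>The extension of \<open>hat_siegel\<close> to all planes, in particular to \<open>satake_space\<close>.\<close>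

definition hat_plane :: "int \<Rightarrow> plane \<Rightarrow> plane" where
  "hat_plane d L = (\<lambda>v. mat_of_real (N_beta d) *v vec_cnj v) ` L"


section \<open>The Baily-Borel compactification and its real points\<close>

definition orbit :: "real mat4 set \<Rightarrow> plane \<Rightarrow> plane set" where
  "orbit G p = {plane_act g p | g. g \<in> G}"

definition baily_borel :: "real mat4 set \<Rightarrow> plane set set" where
  "baily_borel G = orbit G ` satake_space"

definition boundary_stratum_1 :: "real mat4 set \<Rightarrow> plane set set" where
  "boundary_stratum_1 G = orbit G ` boundary_components_1"

text \<open>
  The involution of the orbit space sends an orbit to its image under \<open>hat_plane\<close>, which is again
  an orbit when the group is stable under \<open>hat_Sp\<close> (lemma \<open>hat_orbit\<close> below).
\<close>

definition real_points :: "int \<Rightarrow> real mat4 set \<Rightarrow> plane set set" where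
  "real_points d G = {c \<in> baily_borel G. hat_plane d ` c = c}"


section \<open>Compatibility of the model\<close>

lemma sum_UNIV_Plus: "(\<Sum>i\<in>(UNIV::('a::finite + 'b::finite) set). f i) =
    (\<Sum>k\<in>UNIV. f (Inl k)) + (\<Sum>k\<in>UNIV. f (Inr k))"
  by (subst UNIV_Plus_UNIV[symmetric], subst sum.Plus) simp_all

lemma mat_of_real_mult: "mat_of_real (A ** B) = mat_of_real A ** mat_of_real B"
  by (simp add: mat_of_real_def matrix_matrix_mult_def vec_eq_iff)

lemma mat_of_real_1: "mat_of_real (mat 1) = mat 1"
  by (simp add: mat_of_real_def mat_def vec_eq_iff)

lemma mat_of_real_zero: "mat_of_real 0 = 0"
  by (simp add: mat_of_real_def vec_eq_iff)

lemma mat_of_real_diff: "mat_of_real (A - B) = mat_of_real A - mat_of_real B"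
  by (simp add: mat_of_real_def vec_eq_iff)

lemma mat_of_real_transpose: "mat_of_real (transpose A) = transpose (mat_of_real A)"
  by (simp add: mat_of_real_def transpose_def vec_eq_iff)

lemma mat_of_real_block:
  "mat_of_real (block A B C D) = block (mat_of_real A) (mat_of_real B) (mat_of_real C) (mat_of_real D)"
  by (simp add: mat_of_real_def block_def vec_eq_iff split: sum.split)

lemma block_frame: 
  fixes A B C D P Q :: "complex mat2"
  shows "block A B C D ** frame P Q = frame (A ** P + B ** Q) (C ** P + D ** Q)"
  by (auto simp: block_def frame_def matrix_matrix_mult_def vec_eq_iff sum_UNIV_Plus split: sum.split)

lemma block_mult:
  fixes A B C D A' B' C' D' :: "real mat2"
  shows "block A B C D ** block A' B' C' D' =
    block (A ** A' + B ** C') (A ** B' + B ** D') (C ** A' + D ** C') (C ** B' + D ** D')"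
  by (auto simp: block_def matrix_matrix_mult_def vec_eq_iff sum_UNIV_Plus split: sum.split)

lemma block_1: "block (mat 1) 0 0 (mat 1) = (mat 1 :: real mat4)"
  by (auto simp: block_def mat_def vec_eq_iff split: sum.split)

lemma block_collapse: "block (ulb g) (urb g) (llb g) (lrb g) = g"
  by (auto simp: block_def ulb_def urb_def llb_def lrb_def vec_eq_iff split: sum.split)

lemma block_sel [simp]:
  "ulb (block A B C D) = A" "urb (block A B C D) = B"
  "llb (block A B C D) = C" "lrb (block A B C D) = D"
  by (auto simp: block_def ulb_def urb_def llb_def lrb_def vec_eq_iff)

lemma frame_mult: 
  fixes P Q K :: "complex mat2"
  shows "frame P Q ** K = frame (P ** K) (Q ** K)"
  by (auto simp: frame_def matrix_matrix_mult_def vec_eq_iff split: sum.split)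

lemma mat_cnj_frame: "mat_cnj (frame P Q) = frame (mat_cnj P) (mat_cnj Q)"
  by (auto simp: frame_def mat_cnj_def vec_eq_iff split: sum.split)

lemma mat_cnj_1: "mat_cnj (mat 1) = mat 1"
  by (auto simp: mat_cnj_def mat_def vec_eq_iff)

lemma vec_cnj_mult: "vec_cnj (M *v v) = mat_cnj M *v vec_cnj v"
  by (simp add: vec_cnj_def mat_cnj_def matrix_vector_mult_def vec_eq_iff)

lemma vec_cnj_cnj [simp]: "vec_cnj (vec_cnj v) = v"
  by (simp add: vec_cnj_def vec_eq_iff)

lemma mat_cnj_of_real [simp]: "mat_cnj (mat_of_real M) = mat_of_real M"
  by (simp add: mat_cnj_def mat_of_real_def vec_eq_iff)

lemma column_space_mult:
  assumes "invertible K"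
  shows "column_space (M ** K) = column_space M"
proof -
  obtain K' where K': "K ** K' = mat 1" using assms by (auto simp: invertible_def)
  have "M *v v = (M ** K) *v (K' *v v)" for v
    by (simp add: matrix_vector_mul_assoc matrix_mul_assoc[symmetric] K')
  moreover have "(M ** K) *v v = M *v (K *v v)" for v
    by (simp add: matrix_vector_mul_assoc)
  ultimately show ?thesis unfolding column_space_def by blast
qed

lemma plane_act_column_space: "plane_act g (column_space M) = column_space (mat_of_real g ** M)"
  by (simp add: plane_act_def column_space_def image_image matrix_vector_mul_assoc)

lemma hat_plane_column_space:
  "hat_plane d (column_space M) = column_space (mat_of_real (N_beta d) ** mat_cnj M)"
proof -
  have "range (\<lambda>v. X *v vec_cnj v) = range (\<lambda>v. X *v v)" for X :: frame
    by (auto simp: image_iff) (metis vec_cnj_cnj)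
  then show ?thesis
    by (simp add: hat_plane_def column_space_def image_image matrix_vector_mul_assoc vec_cnj_mult)
qed

lemma matrix_inv_both:
  assumes "invertible Q"
  shows "matrix_inv Q ** Q = mat 1" "Q ** matrix_inv Q = mat 1"
  using someI_ex[OF assms[unfolded invertible_def]] by (simp_all add: matrix_inv_def)

lemma frame_normalize:
  assumes "invertible Q"
  shows "column_space (frame P Q) = siegel_point (P ** matrix_inv Q)"
proof -
  have i: "matrix_inv Q ** Q = mat 1" "Q ** matrix_inv Q = mat 1"
    using assms by (rule matrix_inv_both)+
  have "invertible (matrix_inv Q)" using i unfolding invertible_def by blast
  from column_space_mult[OF this, of "frame P Q"] show ?thesis
    by (simp add: siegel_point_def frame_mult i)
qed

lemma siegel_point_inj: "siegel_point Z = siegel_point W \<longleftrightarrow> Z = W"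
proof
  assume eq: "siegel_point Z = siegel_point W"
  have l: "(frame P (mat 1) *v v) $ Inl k = (P *v v) $ k" for P v k
    by (simp add: frame_def matrix_vector_mult_def)
  have r: "(frame P (mat 1) *v v) $ Inr k = v $ k" for P v k
  proof -
    have "(frame P (mat 1) *v v) $ Inr k = (mat 1 *v v) $ k"
      by (simp only: frame_def matrix_vector_mult_def vec_lambda_beta sum.case)
    then show ?thesis by simp
  qed
  have "Z *v v = W *v v" for v
  proof -
    have "frame Z (mat 1) *v v \<in> siegel_point W"
      using eq unfolding siegel_point_def column_space_def by blast
    then obtain w where w: "frame Z (mat 1) *v v = frame W (mat 1) *v w"
      unfolding siegel_point_def column_space_def by blast
    have "v $ k = w $ k" for k using arg_cong[OF w, of "\<lambda>u. u $ Inr k"] by (simp only: r)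
    then have "v = w" by (simp add: vec_eq_iff)
    moreover have "(Z *v v) $ k = (W *v w) $ k" for k
      using arg_cong[OF w, of "\<lambda>u. u $ Inl k"] by (simp only: l)
    then have "Z *v v = W *v w" by (simp add: vec_eq_iff)
    ultimately show ?thesis by simp
  qed
  then show "Z = W" by (simp add: matrix_eq)
qed simp

lemma beta_square: "beta d ** beta d = of_int d *\<^sub>R mat 1"
proof (cases "d mod 4 = 1")
  case True
  define m where "m = d div 4"
  have d: "d = 4 * m + 1" using True unfolding m_def by presburger
  show ?thesis using True
    by (simp add: beta_def matrix_matrix_mult_def mat_def vec_eq_iff sum_2 forall_2 m_def[symmetric])
       (simp add: d)
next
  case False
  then show ?thesis
    by (simp add: beta_def matrix_matrix_mult_def mat_def vec_eq_iff sum_2 forall_2)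
qed

lemma transpose_beta_square: "transpose (beta d) ** transpose (beta d) = of_int d *\<^sub>R mat 1"
  by (simp add: matrix_transpose_mul[symmetric] beta_square transpose_scalar transpose_mat)

lemma invertible_square:
  fixes M :: "real^'n^'n"
  assumes "M ** M = c *\<^sub>R mat 1" "c \<noteq> 0"
  shows "invertible M"
proof -
  have "(inverse c *\<^sub>R M) ** M = mat 1" "M ** (inverse c *\<^sub>R M) = mat 1"
    using assms by (simp_all add: matrix_scalar_ac scalar_matrix_assoc[symmetric])
  then show ?thesis unfolding invertible_def by blast
qed

lemma N_beta_square: "N_beta d ** N_beta d = of_int d *\<^sub>R mat 1"
proof -
  have "N_beta d ** N_beta d = block (of_int d *\<^sub>R mat 1) 0 0 (of_int d *\<^sub>R mat 1)"
    by (simp add: N_beta_def block_mult beta_square transpose_beta_square)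
  also have "\<dots> = of_int d *\<^sub>R block (mat 1) 0 0 (mat 1)"
    by (auto simp: block_def vec_eq_iff split: sum.split)
  finally show ?thesis by (simp add: block_1)
qed

lemma invertible_N_beta: "d \<noteq> 0 \<Longrightarrow> invertible (N_beta d)"
  by (rule invertible_square[OF N_beta_square]) simp

lemma mat_of_real_invertible: "invertible M \<Longrightarrow> invertible (mat_of_real M)"
  unfolding invertible_def by (metis mat_of_real_1 mat_of_real_mult)

text \<open>On the Siegel space, \<open>hat_plane\<close> and \<open>plane_act\<close> are the given involution and action.\<close>

lemma hat_plane_siegel_point:
  assumes "d \<noteq> 0"
  shows "hat_plane d (siegel_point Z) = siegel_point (hat_siegel d Z)"
proof -
  have "invertible (mat_of_real (transpose (beta d)))"
    using assms by (intro mat_of_real_invertible invertible_square[OF transpose_beta_square]) simp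
  then show ?thesis
    using frame_normalize[of "mat_of_real (transpose (beta d))"]
    by (simp add: siegel_point_def[of Z] hat_plane_column_space mat_cnj_frame mat_cnj_1 N_beta_def
        mat_of_real_block block_frame hat_siegel_def mat_of_real_zero)
qed

lemma hat_plane_act:
  assumes "d \<noteq> 0"
  shows "hat_plane d (plane_act g L) = plane_act (hat_Sp d g) (hat_plane d L)"
proof -
  have "hat_Sp d g ** N_beta d = N_beta d ** g"
    by (simp add: hat_Sp_def matrix_mul_assoc[symmetric] matrix_inv_both invertible_N_beta assms)
  then have "mat_of_real (hat_Sp d g) ** mat_of_real (N_beta d) =
      mat_of_real (N_beta d) ** mat_of_real g"
    by (metis mat_of_real_mult)
  then show ?thesis
    by (simp add: hat_plane_def plane_act_def image_image vec_cnj_mult matrix_vector_mul_assoc)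
qed

lemma hat_Sp_hat_Sp:
  assumes "d \<noteq> 0"
  shows "hat_Sp d (hat_Sp d g) = g"
proof -
  let ?N = "N_beta d" and ?I = "matrix_inv (N_beta d)"
  have i: "?I ** ?N = mat 1" "?N ** ?I = mat 1"
    using assms by (simp_all add: matrix_inv_both invertible_N_beta)
  have N: "?N = of_int d *\<^sub>R ?I"
  proof -
    have "?N ** ?N ** ?I = (of_int d *\<^sub>R mat 1) ** ?I" by (simp only: N_beta_square)
    then show ?thesis
      by (simp add: matrix_mul_assoc[symmetric] i scalar_matrix_assoc[symmetric])
  qed
  have h: "hat_Sp d h = ?I ** h ** ?N" for h
  proof -
    have "(of_int d *\<^sub>R ?I) ** h ** ?I = ?I ** h ** (of_int d *\<^sub>R ?I)"
      by (simp add: matrix_scalar_ac scalar_matrix_assoc[symmetric])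
    then show ?thesis unfolding hat_Sp_def by (simp only: N[symmetric])
  qed
  have "hat_Sp d (hat_Sp d g) = ?I ** (?N ** g ** ?I) ** ?N"
    unfolding h[of "hat_Sp d g"] by (simp only: hat_Sp_def)
  also have "\<dots> = (?I ** ?N) ** g ** (?I ** ?N)" by (simp only: matrix_mul_assoc)
  finally show ?thesis by (simp add: i)
qed

lemma hat_Gamma_hat:
  assumes "d \<noteq> 0"
  shows "hat_Sp d ` Gamma_hat d N = Gamma_hat d N"
proof -
  have "inj (hat_Sp d)" by (metis hat_Sp_hat_Sp[OF assms] injI)
  then show ?thesis
    unfolding Gamma_hat_def
    by (simp add: image_Int image_image hat_Sp_hat_Sp[OF assms] Int_commute)
qed

lemma hat_orbit:
  assumes "d \<noteq> 0" "hat_Sp d ` G = G"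
  shows "hat_plane d ` orbit G p = orbit G (hat_plane d p)"
proof -
  have o: "orbit G q = (\<lambda>g. plane_act g q) ` G" for q unfolding orbit_def by blast
  have "hat_plane d ` orbit G p = (\<lambda>g. plane_act g (hat_plane d p)) ` hat_Sp d ` G"
    by (simp add: o image_image hat_plane_act assms(1))
  then show ?thesis by (simp add: o assms(2))
qed

definition herm :: "complex^2 \<Rightarrow> complex^2 \<Rightarrow> complex" where
  "herm x y = (\<Sum>i\<in>UNIV. cnj (x $ i) * y $ i)"

lemma herm_add: "herm (x + y) z = herm x z + herm y z" "herm x (y + z) = herm x y + herm x z"
  by (simp_all add: herm_def sum.distrib algebra_simps)

lemma herm_diff: "herm x (y - z) = herm x y - herm x z"
  by (simp add: herm_def sum_subtractf algebra_simps)

lemma herm_adjoint: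
  fixes A B :: "real mat2"
  shows "herm (mat_of_real A *v x) (mat_of_real B *v y) =
    herm x (mat_of_real (transpose A ** B) *v y)"
  by (simp add: herm_def mat_of_real_def matrix_vector_mult_def matrix_matrix_mult_def
      transpose_def sum_2 algebra_simps)

lemma herm_siegel:
  assumes "symmetric_mat Z"
  shows "herm (Z *v w) w - herm w (Z *v w) = - 2 * \<i> * of_real
    ((\<chi> i. Re (w $ i)) \<bullet> (mat_Im Z *v (\<chi> i. Re (w $ i))) +
     (\<chi> i. Im (w $ i)) \<bullet> (mat_Im Z *v (\<chi> i. Im (w $ i))))"
proof -
  have s: "Z $ 2 $ 1 = Z $ 1 $ 2"
    using assms unfolding symmetric_mat_def transpose_def vec_eq_iff by force
  show ?thesis
    by (simp add: herm_def mat_Im_def matrix_vector_mult_def inner_vec_def sum_2 s complex_eq_iff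
        algebra_simps)
qed

lemma siegel_denominator:
  assumes "g \<in> Sp4R" "Z \<in> siegel_space"
  shows "invertible (mat_of_real (llb g) ** Z + mat_of_real (lrb g))"
proof -
  obtain A B C D where g: "g = block A B C D"
    and ad: "transpose A ** D - transpose C ** B = mat 1"
    and ac: "transpose (transpose A ** C) = transpose A ** C"
    and bd: "transpose (transpose B ** D) = transpose B ** D"
    using assms(1) unfolding Sp4R_def symmetric_mat_def by blast
  have ac': "transpose C ** A = transpose A ** C" and bd': "transpose D ** B = transpose B ** D"
    using ac bd by (simp_all add: matrix_transpose_mul)
  have da: "transpose D ** A - transpose B ** C = mat 1"
  proof -
    have "transpose (X - Y) = transpose X - transpose Y" for X Y :: "real mat2"
      by (simp add: transpose_def vec_eq_iff)
    then show ?thesis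
      using arg_cong[OF ad, of transpose] by (simp add: matrix_transpose_mul transpose_mat)
  qed
  have pos: "x \<noteq> 0 \<Longrightarrow> x \<bullet> (mat_Im Z *v x) > 0" for x
    using assms(2) unfolding siegel_space_def by auto
  have sym: "symmetric_mat Z" using assms(2) unfolding siegel_space_def by auto
  have "w = 0" if w: "(mat_of_real C ** Z + mat_of_real D) *v w = 0" for w
  proof -
    define p where "p = Z *v w"
    let ?a = "mat_of_real A" let ?b = "mat_of_real B" let ?c = "mat_of_real C" let ?d = "mat_of_real D"
    have 0: "?c *v p + ?d *v w = 0"
      using w by (simp add: p_def matrix_vector_mul_assoc matrix_vector_mult_add_rdistrib)
    have "0 = herm (?a *v p + ?b *v w) (?c *v p + ?d *v w) -
              herm (?c *v p + ?d *v w) (?a *v p + ?b *v w)"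
      by (simp add: 0 herm_def)
    also have "\<dots> = herm p (mat_of_real (transpose A ** D - transpose C ** B) *v w) -
                    herm w (mat_of_real (transpose D ** A - transpose B ** C) *v p)"
      by (simp add: herm_add herm_adjoint ac' bd' mat_of_real_diff matrix_vector_mult_diff_rdistrib
          herm_diff)
    also have "\<dots> = herm p w - herm w p" by (simp add: ad da mat_of_real_1)
    finally have z: "(\<chi> i. Re (w $ i)) \<bullet> (mat_Im Z *v (\<chi> i. Re (w $ i))) +
       (\<chi> i. Im (w $ i)) \<bullet> (mat_Im Z *v (\<chi> i. Im (w $ i))) = 0"
      unfolding p_def herm_siegel[OF sym] by (simp add: complex_eq_iff)
    have nn: "x \<bullet> (mat_Im Z *v x) \<ge> 0" for x
      using pos[of x] by (cases "x = 0") auto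
    have "(\<chi> i. Re (w $ i)) = (0::real^2)" "(\<chi> i. Im (w $ i)) = (0::real^2)"
      using z nn pos by (smt (verit))+
    then show "w = 0" by (simp add: vec_eq_iff complex_eq_iff)
  qed
  then show ?thesis
    unfolding g block_sel invertible_left_inverse matrix_left_invertible_ker by blast
qed

lemma plane_act_siegel_point:
  assumes "g \<in> Sp4R" "Z \<in> siegel_space"
  shows "plane_act g (siegel_point Z) = siegel_point (siegel_act g Z)"
proof -
  have "mat_of_real g = block (mat_of_real (ulb g)) (mat_of_real (urb g))
      (mat_of_real (llb g)) (mat_of_real (lrb g))"
    by (metis block_collapse mat_of_real_block)
  then show ?thesis
    using frame_normalize[OF siegel_denominator[OF assms]]
    by (simp add: siegel_point_def[of Z] plane_act_column_space block_frame siegel_act_def)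
qed

text \<open>
  Convergence in the Grassmannian of planes, expressed through convergence of frames: the points
  of the standard boundary components are the limits of points of the Siegel space named above,
  and \<open>hat_plane\<close> is continuous, so it is the extension by continuity of the involution.
\<close>

definition plane_tendsto :: "('b \<Rightarrow> plane) \<Rightarrow> plane \<Rightarrow> 'b filter \<Rightarrow> bool" where
  "plane_tendsto L L0 F \<longleftrightarrow> (\<exists>M M0. (\<forall>\<^sub>F t in F. L t = column_space (M t)) \<and> L0 = column_space M0 \<and>
     inj ((*v) M0) \<and> (M \<longlongrightarrow> M0) F)"

lemma hat_plane_tendsto:
  assumes "d \<noteq> 0" "plane_tendsto L L0 F"
  shows "plane_tendsto (\<lambda>t. hat_plane d (L t)) (hat_plane d L0) F"
proof -
  obtain M M0 where L: "\<forall>\<^sub>F t in F. L t = column_space (M t)" "L0 = column_space M0"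
    and inj: "inj ((*v) M0)" and lim: "(M \<longlongrightarrow> M0) F"
    using assms(2) unfolding plane_tendsto_def by blast
  let ?h = "\<lambda>X. mat_of_real (N_beta d) ** mat_cnj X"
  have "((\<lambda>t. ?h (M t)) \<longlongrightarrow> ?h M0) F"
    unfolding matrix_matrix_mult_def mat_cnj_def
    by (intro vec_tendstoI) (auto intro!: tendsto_intros tendsto_sum tendsto_vec_nth lim)
  moreover have "inj ((*v) (?h M0))"
  proof (rule injI)
    fix x y assume "?h M0 *v x = ?h M0 *v y"
    then have "mat_of_real (N_beta d) *v (mat_cnj M0 *v x) =
        mat_of_real (N_beta d) *v (mat_cnj M0 *v y)" by (simp add: matrix_vector_mul_assoc)
    then have "mat_cnj M0 *v x = mat_cnj M0 *v y"
      using inj_matrix_vector_mult[OF mat_of_real_invertible[OF invertible_N_beta[OF assms(1)]]]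
      by (auto dest: injD)
    then have "vec_cnj (mat_cnj M0 *v x) = vec_cnj (mat_cnj M0 *v y)" by simp
    then have "M0 *v vec_cnj x = M0 *v vec_cnj y"
      by (simp add: vec_cnj_mult mat_cnj_def)
    then have "vec_cnj x = vec_cnj y" using inj by (auto dest: injD)
    then show "x = y" by (metis vec_cnj_cnj)
  qed
  ultimately show ?thesis
    unfolding plane_tendsto_def
    by (intro exI[of _ "\<lambda>t. ?h (M t)"] exI[of _ "?h M0"])
       (use L(1) in \<open>auto simp: L(2) hat_plane_column_space elim: eventually_mono\<close>)
qed

lemma inverse_ii_at_top:
  "((\<lambda>t::real. inverse (\<i> * of_real t)) \<longlongrightarrow> 0) at_top"
proof -
  have "((\<lambda>t::real. of_real (inverse t) * (- \<i>)) \<longlongrightarrow> of_real 0 * (- \<i>)) at_top"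
    by (intro tendsto_mult tendsto_of_real tendsto_const tendsto_inverse_0_at_top filterlim_ident)
  moreover have "of_real (inverse t) * (- \<i>) = inverse (\<i> * of_real t)" for t :: real
    by simp
  ultimately show ?thesis by (simp only: of_real_0 mult_zero_left)
qed

lemma diag2_mult: "diag2 a b ** diag2 a' b' = diag2 (a * a') (b * b')"
  by (simp add: diag2_def matrix_matrix_mult_def vec_eq_iff forall_2 sum_2)

lemma diag2_1: "diag2 1 1 = mat 1"
  by (simp add: diag2_def mat_def vec_eq_iff forall_2)

lemma diag2_0: "diag2 0 0 = 0"
  by (simp add: diag2_def vec_eq_iff forall_2)

lemma diag2_invertible: "a \<noteq> 0 \<Longrightarrow> b \<noteq> 0 \<Longrightarrow> invertible (diag2 a b)"
  unfolding invertible_def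
  by (rule exI[of _ "diag2 (inverse a) (inverse b)"]) (simp add: diag2_mult diag2_1)

lemma tendsto_diag2:
  "(f \<longlongrightarrow> a) F \<Longrightarrow> (g \<longlongrightarrow> b) F \<Longrightarrow> ((\<lambda>t. diag2 (f t) (g t)) \<longlongrightarrow> diag2 a b) F"
  unfolding diag2_def
  by (intro vec_tendstoI) (simp add: vector_def)

lemma tendsto_frame:
  "(f \<longlongrightarrow> P) F \<Longrightarrow> (g \<longlongrightarrow> Q) F \<Longrightarrow> ((\<lambda>t. frame (f t) (g t)) \<longlongrightarrow> frame P Q) F"
  unfolding frame_def
  by (intro vec_tendstoI) (auto intro!: tendsto_vec_nth split: sum.split)

lemma siegel_point_diag2:
  assumes "b \<noteq> 0"
  shows "siegel_point (diag2 a b) = column_space (frame (diag2 a 1) (diag2 1 (inverse b)))"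
proof -
  have "column_space (frame (diag2 a b) (mat 1) ** diag2 1 (inverse b)) = siegel_point (diag2 a b)"
    unfolding siegel_point_def by (rule column_space_mult) (simp add: diag2_invertible assms)
  then show ?thesis by (simp add: frame_mult diag2_mult assms)
qed

lemma siegel_point_diag2':
  assumes "a \<noteq> 0" "b \<noteq> 0"
  shows "siegel_point (diag2 a b) = column_space (frame (mat 1) (diag2 (inverse a) (inverse b)))"
proof -
  have "column_space (frame (diag2 a b) (mat 1) ** diag2 (inverse a) (inverse b)) =
      siegel_point (diag2 a b)"
    unfolding siegel_point_def by (rule column_space_mult) (simp add: diag2_invertible assms)
  then show ?thesis by (simp add: frame_mult diag2_mult assms diag2_1)
qed

lemma F1_point_limit:
  "plane_tendsto (\<lambda>t::real. siegel_point (diag2 z (\<i> * of_real t))) (F1_point z) at_top"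
proof -
  have "inj ((*v) (frame (diag2 z 1) (diag2 1 0)))"
  proof (rule injI)
    fix x y assume "frame (diag2 z 1) (diag2 1 0) *v x = frame (diag2 z 1) (diag2 1 0) *v y"
    then have "(frame (diag2 z 1) (diag2 1 0) *v x) $ i = (frame (diag2 z 1) (diag2 1 0) *v y) $ i" for i
      by simp
    from this[of "Inl 2"] this[of "Inr 1"] show "x = y"
      by (simp add: frame_def diag2_def matrix_vector_mult_def sum_2 vec_eq_iff forall_2)
  qed
  moreover have "((\<lambda>t::real. frame (diag2 z 1) (diag2 1 (inverse (\<i> * of_real t)))) \<longlongrightarrow>
      frame (diag2 z 1) (diag2 1 0)) at_top"
    by (intro tendsto_frame tendsto_diag2 tendsto_const inverse_ii_at_top)
  moreover have "\<forall>\<^sub>F t in at_top. siegel_point (diag2 z (\<i> * of_real t)) =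
      column_space (frame (diag2 z 1) (diag2 1 (inverse (\<i> * of_real t))))"
    using eventually_gt_at_top[of 0] by eventually_elim (rule siegel_point_diag2, simp)
  ultimately show ?thesis unfolding plane_tendsto_def F1_point_def
    by (intro exI[of _ "\<lambda>t. frame (diag2 z 1) (diag2 1 (inverse (\<i> * of_real t)))"]
        exI[of _ "frame (diag2 z 1) (diag2 1 0)"]) simp
qed

lemma F0_point_limit:
  "plane_tendsto (\<lambda>t::real. siegel_point (diag2 (\<i> * of_real t) (\<i> * of_real t))) F0_point at_top"
proof -
  have "inj ((*v) (frame (mat 1) 0))"
  proof (rule injI)
    fix x y assume "frame (mat 1) 0 *v x = frame (mat 1) 0 *v y"
    then have "(frame (mat 1) 0 *v x) $ i = (frame (mat 1) 0 *v y) $ i" for i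
      by simp
    from this[of "Inl 1"] this[of "Inl 2"] show "x = y"
      by (simp add: frame_def mat_def matrix_vector_mult_def sum_2 vec_eq_iff forall_2)
  qed
  moreover have "((\<lambda>t::real. frame (mat 1) (diag2 (inverse (\<i> * of_real t)) (inverse (\<i> * of_real t)))) \<longlongrightarrow>
      frame (mat 1) (diag2 0 0)) at_top"
    by (intro tendsto_frame tendsto_diag2 tendsto_const inverse_ii_at_top)
  moreover have "\<forall>\<^sub>F t in at_top. siegel_point (diag2 (\<i> * of_real t) (\<i> * of_real t)) =
      column_space (frame (mat 1) (diag2 (inverse (\<i> * of_real t)) (inverse (\<i> * of_real t))))"
    using eventually_gt_at_top[of 0] by eventually_elim (rule siegel_point_diag2', simp_all)
  ultimately show ?thesis unfolding plane_tendsto_def F0_point_def diag2_0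
    by (intro exI[of _ "\<lambda>t. frame (mat 1) (diag2 (inverse (\<i> * of_real t)) (inverse (\<i> * of_real t)))"]
        exI[of _ "frame (mat 1) 0"]) simp
qed

end

theory Submission
  imports Defs
begin

text \<open>
  A real point on the stratum is a boundary point \<open>g (z, i\<infinity>)\<close> whose conjugate is carried to it by
  some \<open>\<gamma>\<close> in the group, so \<open>k = g\<^sup>-\<^sup>1 \<gamma>\<^sup>-\<^sup>1 N\<^sub>\<beta> g\<close>
  composed with complex conjugation fixes \<open>(z, i\<infinity>)\<close>.  The matrix \<open>k\<close> is an integral symplectic
  similitude of multiplier \<open>d\<close>; it scales the line of the cusp by an integer \<open>l\<close> and the dual line
  by \<open>m\<close>, where \<open>l m = d\<close>, and its trace on the remaining plane vanishes.  Since
  \<open>k\<close> is congruent mod \<open>N\<close> to a conjugate of \<open>N\<^sub>\<beta>\<close>, which has trace \<open>0\<close> and square \<open>d\<close>, it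
  follows that \<open>N\<close> divides \<open>l + m\<close> and \<open>l\<^sup>2 - d\<close>.  This is impossible for the given \<open>N\<close>
  when \<open>d \<equiv> 1 (mod 4)\<close>, \<open>d = -2\<close> or \<open>d = -1\<close>, and these are the only cases: for \<open>d < -2\<close> with
  \<open>d \<equiv> 2, 3 (mod 4)\<close> the number \<open>2\<close> is irreducible but not prime.
\<close>

section \<open>Principal rings of integers\<close>

text \<open>Writing \<open>w = p / q\<close> in lowest terms forces \<open>q^2\<close> to divide
  \<open>e\<close>. For elements of the quadratic field with integral trace and norm this bounds the
  denominator of the coefficient of the square root.\<close>

lemma squarefree_mult_square_Ints:
  fixes w :: real
  assumes "squarefree (e :: int)" and "w \<in> \<rat>" and "of_int e * w\<^sup>2 \<in> \<int>"
  shows "w \<in> \<int>"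
proof -
  obtain p q :: int where q: "q > 0" and co: "coprime p q" and w: "w = of_int p / of_int q"
    using Rats_cases'[OF assms(2)] by metis
  obtain n where n: "of_int e * w\<^sup>2 = of_int n" using assms(3) by (auto elim: Ints_cases)
  have "of_int (e * p\<^sup>2) = (of_int (n * q\<^sup>2) :: real)"
    using n q by (simp add: w field_simps)
  then have "e * p\<^sup>2 = n * q\<^sup>2" by (simp only: of_int_eq_iff)
  then have "q\<^sup>2 dvd p\<^sup>2 * e" by (metis dvd_triv_right mult.commute)
  moreover have "coprime (q\<^sup>2) (p\<^sup>2)" using co by (simp add: coprime_commute)
  ultimately have "q\<^sup>2 dvd e" using coprime_dvd_mult_right_iff by blast
  then have "q dvd 1" using assms(1) unfolding squarefree_def by blast
  then have "q = 1" using q by simp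
  then show ?thesis by (simp add: w)
qed

text \<open>With \<open>u = 2 a\<close> and \<open>t = 2 b\<close> this is the equation for an
  element \<open>a + b s\<close> of norm 2, where \<open>s^2 = d\<close>. If
  \<open>d \<le> -5\<close>, size alone gives \<open>\<bar>u\<bar> \<le> 2\<close> and
  \<open>\<bar>t\<bar> \<le> 1\<close>, and only \<open>d = -7\<close> and \<open>d = -8\<close>
  survive.\<close>

lemma square_minus_mult_square_eq_8:
  fixes d u t :: int
  assumes "u\<^sup>2 - d * t\<^sup>2 = 8" and "d < 0"
  shows "d \<ge> -4 \<or> d = -7 \<or> d = -8"
proof (rule ccontr)
  assume "\<not> ?thesis"
  then have d: "d \<le> -5" "d \<noteq> -7" "d \<noteq> -8" by auto
  have "\<bar>u\<bar> \<le> 2"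
  proof (rule ccontr)
    assume "\<not> \<bar>u\<bar> \<le> 2"
    then have "3\<^sup>2 \<le> \<bar>u\<bar>\<^sup>2" by (intro power_mono) auto
    moreover have "d * t\<^sup>2 \<le> 0" using assms(2) by (simp add: mult_le_0_iff)
    ultimately show False using assms(1) by simp
  qed
  then have "u \<in> {-2, -1, 0, 1, 2}" by auto
  then have u: "u\<^sup>2 = 4 \<or> u\<^sup>2 = 1 \<or> u\<^sup>2 = 0" by auto
  have "\<bar>t\<bar> \<le> 1"
  proof (rule ccontr)
    assume "\<not> \<bar>t\<bar> \<le> 1"
    then have "2\<^sup>2 \<le> \<bar>t\<bar>\<^sup>2" by (intro power_mono) auto
    then have "(-d) * t\<^sup>2 \<ge> 5 * 4" using d by (intro mult_mono) auto
    then show False using assms(1) zero_le_power2[of u] by linarith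
  qed
  then have "t\<^sup>2 = 0 \<or> t\<^sup>2 = 1" by (auto simp: abs_le_iff power2_eq_1_iff)
  then show False using u assms(1) d by auto
qed

text \<open>In a principal ideal domain irreducible elements are prime. Outside the two listed
  values no integer has norm 2, so 2 is irreducible; yet 2 divides a norm that is not divisible by
  4, so it is not prime.\<close>

lemma principal_quadratic_integers_discriminant:
  assumes d0: "d < 0" and sf: "squarefree d"
    and pid: "principal_domain (quadratic_integers d)" and d4: "d mod 4 \<noteq> 1"
  shows "d = -1 \<or> d = -2"
proof (rule ccontr)
  assume "\<not> ?thesis"
  have no4: "\<not> 4 dvd d"
  proof
    assume "4 dvd d"
    then have "(2::int)\<^sup>2 dvd d" by simp
    then have "(2::int) dvd 1" using sf unfolding squarefree_def by blast
    then show False by simp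
  qed
  \<comment> \<open>The values -3 and -7 are 1 mod 4, and -4 and -8 are divisible by 4.\<close>
  have dd: "d \<le> -5" "d \<noteq> -7" "d \<noteq> -8"
  proof -
    have "d \<noteq> -3" "d \<noteq> -7" using d4 by auto
    moreover have "d \<noteq> -4" "d \<noteq> -8" using no4 by auto
    ultimately show "d \<le> -5" "d \<noteq> -7" "d \<noteq> -8" using d0 \<open>\<not> (d = -1 \<or> d = -2)\<close> by auto
  qed
  define R where "R = quadratic_integers d"
  define s where "s = csqrt (of_int d)"
  interpret R: principal_domain R using pid by (simp add: R_def)
  have s2: "s * s = of_int d"
    unfolding s_def by (metis power2_csqrt power2_eq_square)
  have s_i: "s = \<i> * of_real (sqrt (of_int (- d)))"
    using d0 csqrt_of_real_nonpos[of "of_int d"] by (simp add: s_def)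
  then have cs: "cnj s = - s" by simp
  have ops [simp]: "mult R = (*)" "add R = (+)" "one R = 1" "zero R = 0"
    by (simp_all add: R_def quadratic_integers_def)
  have car: "x \<in> carrier R \<longleftrightarrow> (\<exists>a b. x = of_rat a + of_rat b * s) \<and> algebraic_int x" for x
    by (auto simp: R_def quadratic_integers_def quadratic_field_def s_def)
  have rep: "\<exists>a b. x = of_rat a + of_rat b * s" if "x \<in> carrier R" for x
    using that unfolding car by (rule conjunct1)
  have crat [simp]: "cnj (of_rat a) = of_rat a" for a
    by (cases a) (simp add: of_rat_rat)
  have cnj_car: "cnj x \<in> carrier R" if x: "x \<in> carrier R" for x
  proof -
    obtain a b where "x = of_rat a + of_rat b * s" using rep[OF x] by blast
    then have "cnj x = of_rat a + of_rat (- b) * s" by (simp add: cs of_rat_minus)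
    moreover have "algebraic_int (cnj x)" using that unfolding car by simp
    ultimately show ?thesis unfolding car by blast
  qed
  have mult_car: "x * y \<in> carrier R" and add_car: "x + y \<in> carrier R"
    if "x \<in> carrier R" "y \<in> carrier R" for x y
    using R.m_closed[OF that] R.a_closed[OF that] by simp_all
  have one_car: "1 \<in> carrier R" using R.one_closed by simp
  have s_car: "s \<in> carrier R"
  proof -
    have "s = of_rat 0 + of_rat 1 * s" by simp
    moreover have "algebraic_int s"
      unfolding s_def by (intro algebraic_int_csqrt int_imp_algebraic_int) simp
    ultimately show ?thesis unfolding car by blast
  qed
  have int_rat: "x \<in> \<int>" if "x \<in> carrier R" "x \<in> \<rat>" for x
    using that unfolding car by (auto intro: rational_algebraic_int_is_int)
  \<comment> \<open>The norm is rational because the terms in \<open>s\<close> cancel, and a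
    rational algebraic integer is an integer. Its sign comes from the squared modulus.\<close>
  have norm: "\<exists>n. x * cnj x = of_int n \<and> n \<ge> 0" if x: "x \<in> carrier R" for x
  proof -
    obtain a b where ab: "x = of_rat a + of_rat b * s" using rep[OF x] by blast
    have "x * cnj x = of_rat a * of_rat a - of_rat b * of_rat b * (s * s)"
      by (simp add: ab cs algebra_simps)
    then have "x * cnj x \<in> \<rat>" by (simp add: s2)
    then have "x * cnj x \<in> \<int>" by (intro int_rat mult_car cnj_car that)
    then obtain n where n: "x * cnj x = of_int n" by (auto elim: Ints_cases)
    have "complex_of_real ((cmod x)\<^sup>2) = of_real (of_int n)"
      using complex_norm_square[of x] n by simp
    then have "(cmod x)\<^sup>2 = of_int n" by (simp only: of_real_eq_iff)
    then have "(of_int n :: real) \<ge> 0" by (metis zero_le_power2)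
    with n show ?thesis by auto
  qed
  have norm_unit: "x \<in> Units R" if "x \<in> carrier R" "x * cnj x = 1" for x
    using that cnj_car[OF that(1)] by (auto simp: Units_def mult.commute)
  \<comment> \<open>The trace \<open>2 a\<close> is an integer \<open>u\<close>, so norm 2 reads
    \<open>d (2 b)^2 = u^2 - 8\<close>, and squarefreeness of \<open>d\<close> makes
    \<open>2 b\<close> an integer as well.\<close>
  have no_norm_2: "x * cnj x \<noteq> 2" if x: "x \<in> carrier R" for x
  proof
    assume nx: "x * cnj x = 2"
    obtain a b where ab: "x = of_rat a + of_rat b * s" using rep[OF x] by blast
    have "x + cnj x = 2 * of_rat a" by (simp add: ab cs)
    then have "x + cnj x \<in> \<rat>" by simp
    then have "x + cnj x \<in> \<int>" by (intro int_rat add_car cnj_car that)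
    then obtain u where "2 * of_rat a = (of_int u :: complex)"
      using \<open>x + cnj x = 2 * of_rat a\<close> by (auto elim: Ints_cases)
    then have "of_rat (2 * a) = (of_rat (of_int u) :: complex)" by (simp add: of_rat_mult)
    then have u: "2 * a = of_int u" by (simp only: of_rat_eq_iff)
    have "of_rat (a\<^sup>2 - of_int d * b\<^sup>2) = x * cnj x"
      using s2 by (simp add: ab cs algebra_simps of_rat_diff of_rat_mult power2_eq_square)
    then have "of_rat (a\<^sup>2 - of_int d * b\<^sup>2) = (of_rat 2 :: complex)" by (simp add: nx)
    then have e: "a\<^sup>2 - of_int d * b\<^sup>2 = 2" by (simp only: of_rat_eq_iff)
    have "(2 * a)\<^sup>2 - of_int d * (2 * b)\<^sup>2 = 4 * (a\<^sup>2 - of_int d * b\<^sup>2)"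
      by (simp add: algebra_simps power2_eq_square)
    then have "of_int d * (2 * b)\<^sup>2 = of_int (u\<^sup>2 - 8)" using e u by simp
    then have "of_rat (of_int d * (2 * b)\<^sup>2) = (of_rat (of_int (u\<^sup>2 - 8)) :: real)" by simp
    then have db: "of_int d * (of_rat (2 * b))\<^sup>2 = (of_int (u\<^sup>2 - 8) :: real)"
      by (simp only: of_rat_mult of_rat_power of_rat_of_int_eq)
    have "(of_rat (2 * b) :: real) \<in> \<int>"
    proof (rule squarefree_mult_square_Ints[OF sf])
      show "of_rat (2 * b) \<in> \<rat>" by (rule Rats_of_rat)
      show "of_int d * (of_rat (2 * b))\<^sup>2 \<in> (\<int> :: real set)" unfolding db by (rule Ints_of_int)
    qed
    then obtain t where t: "(of_rat (2 * b) :: real) = of_int t" by (auto elim: Ints_cases)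
    have "d * t\<^sup>2 = u\<^sup>2 - 8"
      using db unfolding t by (metis of_int_eq_iff of_int_mult of_int_power)
    then show False using square_minus_mult_square_eq_8[of u d t] d0 dd by auto
  qed
  have two_car: "2 \<in> carrier R" using add_car[OF one_car one_car] by simp
  \<comment> \<open>The norms of two factors of 2 multiply to 4 and neither is 2, so one of them is
    1 and that factor is a unit.\<close>
  have "ring_irreducible\<^bsub>R\<^esub> 2"
  proof (rule R.ring_irreducibleI)
    show "2 \<in> carrier R - {\<zero>\<^bsub>R\<^esub>}" using two_car by simp
    show "2 \<notin> Units R"
    proof
      assume "2 \<in> Units R"
      then obtain y where "y \<in> carrier R" "2 * y = 1" by (auto simp: Units_def mult.commute)
      have "4 * (y * cnj y) = (2 * y) * cnj (2 * y)" by simp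
      then have "4 * (y * cnj y) = 1" by (simp only: \<open>2 * y = 1\<close>) simp
      moreover obtain n where "y * cnj y = of_int n" using norm \<open>y \<in> carrier R\<close> by blast
      ultimately have "of_int (4 * n) = (of_int 1 :: complex)" by simp
      then have "4 * n = 1" by (simp only: of_int_eq_iff)
      then show False by presburger
    qed
    fix x y assume x: "x \<in> carrier R" and y: "y \<in> carrier R" and "2 = x \<otimes>\<^bsub>R\<^esub> y"
    then have xy: "x * y = 2" by simp
    obtain m where m: "x * cnj x = of_int m" "m \<ge> 0" using norm x by blast
    obtain n where n: "y * cnj y = of_int n" "n \<ge> 0" using norm y by blast
    have "of_int (m * n) = (x * y) * cnj (x * y)" by (simp add: m(1)[symmetric] n(1)[symmetric])
    then have "of_int (m * n) = (of_int 4 :: complex)" by (simp add: xy)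
    then have mn: "m * n = 4" by (simp only: of_int_eq_iff)
    then have "m dvd 4" by (metis dvd_triv_left)
    then have "m \<le> 4" by (rule zdvd_imp_le) simp
    moreover have "m \<noteq> 2" using no_norm_2[OF x] m(1) by auto
    moreover have "m \<noteq> 0" "m \<noteq> 3" using mn by (auto, presburger)
    ultimately have "m = 1 \<or> m = 4" using m(2) by auto
    then have "m = 1 \<or> n = 1" using mn by auto
    then show "x \<in> Units R \<or> y \<in> Units R" using norm_unit x y m(1) n(1) by auto
  qed
  then have "ring_prime\<^bsub>R\<^esub> 2"
    using R.primeness_condition[OF two_car] by simp
  then have pr: "prime R 2" unfolding ring_prime_def by simp
  have div2: "\<exists>n. x * cnj x = of_int (4 * n)" if "2 divides\<^bsub>R\<^esub> x" for x
  proof -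
    obtain y where "y \<in> carrier R" "x = 2 * y" using \<open>2 divides\<^bsub>R\<^esub> x\<close> by (auto simp: factor_def)
    then have "x * cnj x = 4 * (y * cnj y)" by simp
    then show ?thesis using norm[OF \<open>y \<in> carrier R\<close>] by (metis of_int_mult of_int_numeral)
  qed
  have int_car: "of_int k \<in> carrier R" for k
  proof -
    have "of_int k = of_rat (of_int k) + of_rat 0 * s" by simp
    moreover have "algebraic_int (of_int k :: complex)" by (intro int_imp_algebraic_int) simp
    ultimately show ?thesis unfolding car by blast
  qed
  \<comment> \<open>Adding the parity \<open>r\<close> of \<open>d\<close> makes the norm of
    \<open>r + s\<close> even: it equals \<open>r - d\<close> because
    \<open>r^2 = r\<close>.\<close>
  define r where "r = d mod 2"
  have r: "r = 0 \<or> r = 1" unfolding r_def by presburger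
  let ?x = "of_int r + s"
  have x_car: "?x \<in> carrier R" by (intro add_car int_car s_car)
  have nx: "?x * cnj ?x = of_int (r - d)" using r s2 by (auto simp: cs algebra_simps)
  have even: "even (r - d)" unfolding r_def by presburger
  then obtain k where k: "r - d = 2 * k" by (elim evenE)
  have "2 divides\<^bsub>R\<^esub> (?x * cnj ?x)"
    unfolding factor_def using int_car[of k] k nx by (metis of_int_mult of_int_numeral ops(1))
  then have "2 divides\<^bsub>R\<^esub> ?x \<or> 2 divides\<^bsub>R\<^esub> (cnj ?x)"
    using pr x_car cnj_car[OF x_car] unfolding prime_def by auto
  then have "\<exists>n. ?x * cnj ?x = of_int (4 * n)"
    \<comment> \<open>An element and its conjugate have the same norm, so both alternatives give
      divisibility by 4.\<close>
    using div2[of ?x] div2[of "cnj ?x"] by (metis complex_cnj_cnj mult.commute)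
  then obtain n where "of_int (r - d) = (of_int (4 * n) :: complex)" unfolding nx by blast
  then have "r - d = 4 * n" by (simp only: of_int_eq_iff)
  then show False using r d4 no4 unfolding r_def by presburger
qed


section \<open>Integral symplectic similitudes\<close>

definition symplectic_form :: "real mat4" where
  "symplectic_form = block 0 (mat 1) (- mat 1) 0"

text \<open>The multiplier is a parameter because \<open>N_beta d\<close> scales the form by
  \<open>d\<close> instead of preserving it.\<close>

definition similitude :: "real \<Rightarrow> real mat4 \<Rightarrow> bool" where
  "similitude c M \<longleftrightarrow> transpose M ** symplectic_form ** M = c *\<^sub>R symplectic_form"

definition integral_mat :: "real^'m^'n \<Rightarrow> bool" where
  "integral_mat M \<longleftrightarrow> (\<forall>i j. M $ i $ j \<in> \<int>)"

lemma integral_mat_mult: "integral_mat A \<Longrightarrow> integral_mat B \<Longrightarrow> integral_mat (A ** B)"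
  by (auto simp: integral_mat_def matrix_matrix_mult_def intro!: Ints_sum Ints_mult)

lemma integral_mat_add: "integral_mat A \<Longrightarrow> integral_mat B \<Longrightarrow> integral_mat (A + B)"
  by (simp add: integral_mat_def)

lemma integral_mat_uminus: "integral_mat A \<Longrightarrow> integral_mat (- A)"
  by (simp add: integral_mat_def)

lemma integral_mat_transpose: "integral_mat A \<Longrightarrow> integral_mat (transpose A)"
  by (simp add: integral_mat_def transpose_def)

lemma integral_mat_block:
  "integral_mat A \<Longrightarrow> integral_mat B \<Longrightarrow> integral_mat C \<Longrightarrow> integral_mat D \<Longrightarrow>
    integral_mat (block A B C D)"
  by (auto simp: integral_mat_def block_def split: sum.split)

lemma integral_mat_1: "integral_mat (mat 1)" and integral_mat_0: "integral_mat 0"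
  by (auto simp: integral_mat_def mat_def)

lemmas integral_mat_intros = integral_mat_mult integral_mat_add integral_mat_uminus
  integral_mat_transpose integral_mat_block integral_mat_1 integral_mat_0

lemma integral_symplectic_form: "integral_mat symplectic_form"
  unfolding symplectic_form_def by (intro integral_mat_intros)

lemma integral_N_beta: "integral_mat (N_beta d)"
proof -
  have "integral_mat (beta d)"
    by (simp add: integral_mat_def beta_def forall_2)
  then show ?thesis unfolding N_beta_def by (intro integral_mat_intros)
qed

section \<open>Block criterion for similitudes, and integral inverses\<close>

lemma transpose_block:
  "transpose (block A B C D) = block (transpose A) (transpose C) (transpose B) (transpose D)"
  by (auto simp: block_def transpose_def vec_eq_iff split: sum.split)

lemma transpose_0: "transpose 0 = (0 :: 'a::zero^'m^'n)"
  by (simp add: transpose_def vec_eq_iff)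

lemma matrix_minus_left: "(- A) ** B = - (A ** B)" for A :: "real^'m^'n"
  by (simp add: matrix_matrix_mult_def vec_eq_iff sum_negf)

lemma matrix_minus_right: "A ** (- B) = - (A ** B)" for A :: "real^'m^'n"
  by (simp add: matrix_matrix_mult_def vec_eq_iff sum_negf)

lemma matrix_add_rdistrib: "(B + C) ** A = B ** A + C ** A" for A :: "real^'m^'n"
  by (simp add: matrix_matrix_mult_def vec_eq_iff sum.distrib distrib_right)

lemma symplectic_form_square: "symplectic_form ** symplectic_form = - mat 1"
proof -
  have "block (- mat 1) 0 0 (- mat 1) = - block (mat 1) 0 0 (mat 1 :: real mat2)"
    by (auto simp: block_def vec_eq_iff split: sum.split)
  then show ?thesis
    by (simp add: symplectic_form_def block_mult block_1 matrix_minus_left)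
qed

lemma similitude_block:
  "similitude c (block A B C D) \<longleftrightarrow>
    block (transpose A ** C - transpose C ** A) (transpose A ** D - transpose C ** B)
      (transpose B ** C - transpose D ** A) (transpose B ** D - transpose D ** B) =
    c *\<^sub>R symplectic_form"
  by (simp add: similitude_def symplectic_form_def transpose_block block_mult matrix_minus_left
      matrix_minus_right)

text \<open>The defining conditions of \<open>Sp4R\<close> are the two diagonal blocks and the upper
  right block of the matrix equation; the lower left block is minus the transpose of the upper right
  one.\<close>

lemma Sp4R_similitude:
  assumes "g \<in> Sp4R"
  shows "similitude 1 g"
proof -
  obtain A B C D where g: "g = block A B C D"
    and ad: "transpose A ** D - transpose C ** B = mat 1"
    and ac: "transpose (transpose A ** C) = transpose A ** C"
    and bd: "transpose (transpose B ** D) = transpose B ** D"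
    using assms unfolding Sp4R_def symmetric_mat_def by blast
  have tdiff: "transpose (X - Y) = transpose X - transpose Y" for X Y :: "real mat2"
    by (simp add: transpose_def vec_eq_iff)
  have "transpose D ** A - transpose B ** C = mat 1"
    using arg_cong[OF ad, of transpose] by (simp add: tdiff matrix_transpose_mul transpose_mat)
  then have "transpose B ** C - transpose D ** A = - mat 1" by (metis minus_diff_eq)
  then show ?thesis
    using ac bd ad
    by (simp add: g similitude_block symplectic_form_def matrix_transpose_mul)
qed

lemma similitude_N_beta: "similitude (of_int d) (N_beta d)"
proof -
  show ?thesis
    unfolding N_beta_def similitude_block
    by (auto simp: transpose_0 transpose_beta_square beta_square symplectic_form_def block_def vec_eq_iff
        split: sum.split)
qed

lemma similitude_mult:
  assumes "similitude c A" and "similitude c' B"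
  shows "similitude (c * c') (A ** B)"
proof -
  have "transpose (A ** B) ** symplectic_form ** (A ** B) =
      transpose B ** (transpose A ** symplectic_form ** A) ** B"
    by (simp add: matrix_transpose_mul matrix_mul_assoc)
  then show ?thesis
    using assms by (simp add: similitude_def matrix_scalar_ac scalar_matrix_assoc[symmetric])
qed

text \<open>With \<open>J\<close> the symplectic form, \<open>J^2 = -1\<close> and invariance of
  \<open>J\<close> under \<open>g\<close> make \<open>- J (transpose g) J\<close> the inverse, and
  this formula shows its integrality.\<close>

lemma Sp4Z_inverse:
  assumes "g \<in> Sp4Z"
  obtains h where "integral_mat h" "similitude 1 h" "h ** g = mat 1" "g ** h = mat 1"
proof
  let ?J = symplectic_form
  let ?h = "- (?J ** transpose g ** ?J)"
  have g: "integral_mat g" and sg: "transpose g ** ?J ** g = ?J"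
    using assms Sp4R_similitude[of g] by (auto simp: Sp4Z_def integral_mat_def similitude_def)
  show "integral_mat ?h" by (intro integral_mat_intros integral_symplectic_form g)
  have "?h ** g = - (?J ** (transpose g ** ?J ** g))"
    by (simp add: matrix_minus_left matrix_mul_assoc)
  then show h: "?h ** g = mat 1" by (simp add: sg symplectic_form_square)
  then show h': "g ** ?h = mat 1" by (simp only: matrix_left_right_inverse)
  have "transpose ?h ** ?J ** ?h = transpose ?h ** (transpose g ** ?J ** g) ** ?h"
    by (simp only: sg)
  also have "\<dots> = transpose (g ** ?h) ** ?J ** (g ** ?h)"
    by (simp only: matrix_transpose_mul matrix_mul_assoc)
  finally show "similitude 1 ?h" by (simp add: similitude_def h' transpose_mat)
qed

lemma trace_N_beta: "trace (N_beta d) = 0"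
  by (simp add: trace_def sum_UNIV_Plus N_beta_def block_def transpose_def beta_def sum_2)

section \<open>Fixed points on the standard boundary component\<close>

text \<open>The frame sends \<open>(a, b)\<close> to \<open>(z a, b, a, 0)\<close>; replacing this
  parametrization by two linear equations lets membership be read off from coordinates.\<close>

lemma mem_F1_point: "v \<in> F1_point z \<longleftrightarrow> v $ Inl 1 = z * v $ Inr 1 \<and> v $ Inr 2 = 0"
proof -
  define M where "M = frame (diag2 z 1) (diag2 1 0)"
  have M: "(M *v w) $ Inl 1 = z * w $ 1" "(M *v w) $ Inl 2 = w $ 2"
    "(M *v w) $ Inr 1 = w $ 1" "(M *v w) $ Inr 2 = 0" for w
    by (simp_all add: M_def frame_def diag2_def matrix_vector_mult_def sum_2)
  have F: "F1_point z = range ((*v) M)"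
    by (simp add: F1_point_def column_space_def M_def)
  show ?thesis
  proof
    assume "v \<in> F1_point z"
    then show "v $ Inl 1 = z * v $ Inr 1 \<and> v $ Inr 2 = 0" unfolding F by (auto simp: M)
  next
    assume v: "v $ Inl 1 = z * v $ Inr 1 \<and> v $ Inr 2 = 0"
    have "v = M *v vector [v $ Inr 1, v $ Inl 2]"
      unfolding vec_eq_iff split_sum_all forall_2 by (simp only: M v vector_2 simp_thms)
    then show "v \<in> F1_point z" unfolding F by (rule range_eqI)
  qed
qed

lemma mat4_vec_nth:
  fixes v :: "complex^(2 + 2)"
  shows "(mat_of_real k *v v) $ i = of_real (k $ i $ Inl 1) * v $ Inl 1 +
    of_real (k $ i $ Inl 2) * v $ Inl 2 + of_real (k $ i $ Inr 1) * v $ Inr 1 +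
    of_real (k $ i $ Inr 2) * v $ Inr 2"
  by (simp add: matrix_vector_mult_def mat_of_real_def sum_UNIV_Plus sum_2)

text \<open>
  On the standard component, \<open>k\<close> composed with conjugation is an antiholomorphic map
  \<open>z \<mapsto> M (cnj z)\<close> of the upper half plane; it has a fixed point only if it is a reflection,
  that is, if \<open>M\<close> is traceless.
\<close>

lemma F1_antiholomorphic_fixed_point:
  fixes k :: "real mat4"
  assumes z: "Im z > 0"
    and inv: "\<And>v. v \<in> F1_point z \<Longrightarrow> mat_of_real k *v vec_cnj v \<in> F1_point z"
  shows "\<And>i. i \<noteq> Inl 2 \<Longrightarrow> k $ i $ Inl 2 = 0"
    and "trace k = k $ Inl 2 $ Inl 2 + k $ Inr 2 $ Inr 2"
proof -
  have ne: "(1::2) \<noteq> 2" "(2::2) \<noteq> 1" by simp_all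
  \<comment> \<open>These two vectors span \<open>F1_point z\<close>: \<open>?a\<close> is the real
    direction of the cusp, and \<open>?b\<close> carries the dependence on \<open>z\<close>.\<close>
  let ?a = "(\<chi> i. if i = Inl 2 then 1 else 0) :: complex^(2 + 2)"
  let ?b = "(\<chi> i. if i = Inl 1 then z else if i = Inr 1 then 1 else 0) :: complex^(2 + 2)"
  have "mat_of_real k *v vec_cnj ?a \<in> F1_point z"
    by (rule inv) (simp add: mem_F1_point ne)
  then have a: "of_real (k $ Inl 1 $ Inl 2) = z * of_real (k $ Inr 1 $ Inl 2)"
      "k $ Inr 2 $ Inl 2 = 0"
    by (simp_all add: mem_F1_point mat4_vec_nth vec_cnj_def ne)
  \<comment> \<open>Both entries are real and \<open>z\<close> is not, so the relation holds only if
    both vanish.\<close>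
  have "k $ Inr 1 $ Inl 2 = 0" using arg_cong[OF a(1), of Im] z by simp
  with a have col: "k $ Inl 1 $ Inl 2 = 0" "k $ Inr 1 $ Inl 2 = 0" "k $ Inr 2 $ Inl 2 = 0"
    by simp_all
  show "k $ i $ Inl 2 = 0" if "i \<noteq> Inl 2" for i
  proof (cases i)
    case (Inl j)
    then show ?thesis using that col exhaust_2[of j] by auto
  next
    case (Inr j)
    then show ?thesis using that col exhaust_2[of j] by auto
  qed
  have "mat_of_real k *v vec_cnj ?b \<in> F1_point z"
    by (rule inv) (simp add: mem_F1_point ne)
  then have "of_real (k $ Inl 1 $ Inl 1) * cnj z + of_real (k $ Inl 1 $ Inr 1) =
      z * (of_real (k $ Inr 1 $ Inl 1) * cnj z + of_real (k $ Inr 1 $ Inr 1))"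
    by (simp add: mem_F1_point mat4_vec_nth vec_cnj_def ne)
  \<comment> \<open>The product of \<open>z\<close> and its conjugate is real, so only the two
    diagonal entries contribute to the imaginary part.\<close>
  from arg_cong[OF this, of Im] have "Im z * (k $ Inl 1 $ Inl 1 + k $ Inr 1 $ Inr 1) = 0"
    by (simp add: algebra_simps)
  then have "k $ Inl 1 $ Inl 1 + k $ Inr 1 $ Inr 1 = 0" using z by simp
  then show "trace k = k $ Inl 2 $ Inl 2 + k $ Inr 2 $ Inr 2"
    by (simp add: trace_def sum_UNIV_Plus sum_2)
qed

lemma sum_single_nonzero:
  fixes f :: "'a::finite \<Rightarrow> 'b::comm_monoid_add"
  assumes "\<And>j. j \<noteq> i \<Longrightarrow> f j = 0"
  shows "sum f UNIV = f i"
proof -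
  have "sum f UNIV = f i + sum f (UNIV - {i})" by (rule sum.remove) simp_all
  also have "sum f (UNIV - {i}) = 0" using assms by (intro sum.neutral) blast
  finally show ?thesis by simp
qed

text \<open>The basis vectors \<open>Inl 2\<close> and \<open>Inr 2\<close> pair to 1, so their
  images under \<open>k\<close> pair to \<open>c\<close>. Since the first image is a multiple of its
  basis vector, this pairing is the product of the two diagonal entries.\<close>

lemma similitude_eigenvalues:
  assumes "similitude c k" and "\<And>i. i \<noteq> Inl 2 \<Longrightarrow> k $ i $ Inl 2 = 0"
  shows "k $ Inl 2 $ Inl 2 * k $ Inr 2 $ Inr 2 = c"
proof -
  have "(transpose k ** (symplectic_form ** k)) $ Inl 2 $ Inr 2 =
      k $ Inl 2 $ Inl 2 * (symplectic_form ** k) $ Inl 2 $ Inr 2"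
    unfolding matrix_matrix_mult_def[of "transpose k"]
    by (simp add: transpose_def, rule sum_single_nonzero) (simp add: assms(2))
  also have "(symplectic_form ** k) $ Inl 2 $ Inr 2 = k $ Inr 2 $ Inr 2"
    by (simp add: matrix_matrix_mult_def symplectic_form_def block_def sum_UNIV_Plus sum_2 mat_def)
  finally show ?thesis
    using assms(1) unfolding similitude_def matrix_mul_assoc[symmetric]
    by (simp add: symplectic_form_def block_def mat_def)
qed

section \<open>Congruences at a real boundary point\<close>

text \<open>The numbers \<open>l\<close> and \<open>m\<close> are the diagonal entries of
  \<open>k\<close> at the cusp line and its dual. Both divisibilities come from comparing
  \<open>k\<close> modulo \<open>N\<close> with the conjugate \<open>K\<close> of
  \<open>N_beta d\<close>, once through the trace and once through the square.\<close>

lemma real_boundary_point_eigenvalues: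
  assumes d: "d \<noteq> 0" and \<gamma>: "\<gamma> \<in> Gamma_principal N" and g: "g \<in> Sp4Z" and z: "Im z > 0"
    and hat: "hat_plane d (plane_act g (F1_point z)) = plane_act \<gamma> (plane_act g (F1_point z))"
  obtains l m :: int where "l * m = d" and "int N dvd l + m" and "int N dvd l\<^sup>2 - d"
proof -
  let ?B = "N_beta d"
  have \<gamma>Z: "\<gamma> \<in> Sp4Z" using \<gamma> by (simp add: Gamma_principal_def)
  obtain h where h: "integral_mat h" "similitude 1 h" "h ** g = mat 1" "g ** h = mat 1"
    using Sp4Z_inverse[OF g] .
  obtain \<delta> where \<delta>: "integral_mat \<delta>" "similitude 1 \<delta>" "\<delta> ** \<gamma> = mat 1" "\<gamma> ** \<delta> = mat 1"
    using Sp4Z_inverse[OF \<gamma>Z] .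
  have gi: "integral_mat g" "similitude 1 g"
    using g Sp4R_similitude[of g] by (auto simp: Sp4Z_def integral_mat_def)
  define k where "k = h ** \<delta> ** ?B ** g"
  have "similitude (1 * 1 * of_int d * 1) k"
    unfolding k_def by (intro similitude_mult similitude_N_beta h \<delta> gi)
  then have sim: "similitude (of_int d) k" by simp
  have ki: "integral_mat k" unfolding k_def by (intro integral_mat_intros integral_N_beta h \<delta> gi)
  have inv: "mat_of_real k *v vec_cnj v \<in> F1_point z" if v: "v \<in> F1_point z" for v
  proof -
    have "mat_of_real ?B *v vec_cnj (mat_of_real g *v v) \<in> plane_act \<gamma> (plane_act g (F1_point z))"
      unfolding hat[symmetric] using v by (auto simp: hat_plane_def plane_act_def)
    then obtain f where f: "f \<in> F1_point z" and
      e: "mat_of_real ?B *v vec_cnj (mat_of_real g *v v) = mat_of_real \<gamma> *v (mat_of_real g *v f)"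
      by (auto simp: plane_act_def)
    have "mat_of_real k *v vec_cnj v =
        mat_of_real (h ** \<delta>) *v (mat_of_real ?B *v vec_cnj (mat_of_real g *v v))"
      by (simp add: k_def mat_of_real_mult vec_cnj_mult matrix_vector_mul_assoc matrix_mul_assoc)
    also have "\<dots> = mat_of_real (h ** (\<delta> ** \<gamma>) ** g) *v f"
      unfolding e by (simp only: mat_of_real_mult matrix_vector_mul_assoc matrix_mul_assoc)
    also have "\<dots> = f" by (simp add: h \<delta> mat_of_real_1)
    finally show ?thesis using f by simp
  qed
  note col = F1_antiholomorphic_fixed_point(1)[OF z inv]
    and tr = F1_antiholomorphic_fixed_point(2)[OF z inv]
  obtain l m where l: "k $ Inl 2 $ Inl 2 = of_int l" and m: "k $ Inr 2 $ Inr 2 = of_int m"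
    using ki unfolding integral_mat_def by (metis Ints_cases)
  have "of_int (l * m) = (of_int d :: real)"
    using similitude_eigenvalues[OF sim col] by (simp add: l m)
  then have lm: "l * m = d" by (simp only: of_int_eq_iff)

  have "\<exists>E. integral_mat E \<and> \<gamma> = mat 1 + real N *\<^sub>R E"
  proof -
    have "\<forall>i j. \<exists>e::int. \<gamma> $ i $ j - mat 1 $ i $ j = real N * of_int e"
      using \<gamma> by (simp add: Gamma_principal_def)
    then obtain e :: "2 + 2 \<Rightarrow> 2 + 2 \<Rightarrow> int"
      where e: "\<And>i j. \<gamma> $ i $ j - mat 1 $ i $ j = real N * of_int (e i j)" by metis
    have "\<gamma> = mat 1 + real N *\<^sub>R (\<chi> i j. of_int (e i j))"
      by (simp add: vec_eq_iff e[symmetric])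
    then show ?thesis by (intro exI[of _ "\<chi> i j. of_int (e i j)"]) (simp add: integral_mat_def)
  qed
  then obtain E where E: "integral_mat E" "\<gamma> = mat 1 + real N *\<^sub>R E" by blast
  define K where "K = h ** ?B ** g"
  define X where "X = h ** \<delta> ** E ** ?B ** g"
  have Ki: "integral_mat K" unfolding K_def by (intro integral_mat_intros integral_N_beta h gi)
  have Xi: "integral_mat X" unfolding X_def by (intro integral_mat_intros integral_N_beta h gi \<delta> E)
  \<comment> \<open>Inserting \<open>\<delta> ** \<gamma> = mat 1\<close> and expanding
    \<open>\<gamma>\<close> as the identity plus \<open>N\<close> times \<open>E\<close> isolates
    the error term \<open>X\<close>.\<close>
  have "K = h ** (\<delta> ** \<gamma>) ** ?B ** g" by (simp add: K_def \<delta>)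
  also have "\<dots> = k + real N *\<^sub>R X"
    by (simp add: E(2) k_def X_def matrix_add_ldistrib matrix_add_rdistrib matrix_mul_assoc
        matrix_scalar_ac scalar_matrix_assoc[symmetric])
  finally have kK: "K = k + real N *\<^sub>R X" .
  have "trace K = trace (g ** (h ** ?B))" unfolding K_def by (rule trace_mul_sym)
  also have "\<dots> = 0" by (simp add: matrix_mul_assoc h trace_N_beta)
  finally have "trace K = 0" .
  then have "trace k = - real N * trace X"
    unfolding kK by (simp add: trace_def sum.distrib sum_distrib_left[symmetric])
  moreover have "trace X \<in> \<int>" using Xi by (auto simp: trace_def integral_mat_def)
  ultimately obtain t where "trace k = - real N * of_int t" by (metis Ints_cases)
  then have "of_int (l + m) = (of_int (- (int N) * t) :: real)" using tr by (simp add: l m)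
  then have "l + m = - int N * t" by (simp only: of_int_eq_iff)
  then have dvd1: "int N dvd l + m" by simp

  have "K ** K = h ** ?B ** (g ** h) ** ?B ** g" by (simp only: K_def matrix_mul_assoc)
  also have "\<dots> = h ** (?B ** ?B) ** g" by (simp add: h matrix_mul_assoc)
  also have "\<dots> = of_int d *\<^sub>R mat 1"
    by (simp add: N_beta_square matrix_scalar_ac scalar_matrix_assoc[symmetric] h)
  finally have KK: "K ** K = of_int d *\<^sub>R mat 1" .
  \<comment> \<open>The two factors of \<open>K ** K\<close> are replaced one after the other, so
    the error remains \<open>N\<close> times an integral matrix.\<close>
  have "K ** M = k ** M + real N *\<^sub>R (X ** M)" for M :: "real mat4"
    by (simp add: kK matrix_add_rdistrib scalar_matrix_assoc[symmetric])
  moreover have "k ** K = k ** k + real N *\<^sub>R (k ** X)"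
    by (simp add: kK matrix_add_ldistrib matrix_scalar_ac scalar_matrix_assoc[symmetric])
  ultimately have "K ** K = k ** k + real N *\<^sub>R (k ** X + X ** K)"
    by (simp add: scaleR_add_right add.assoc)
  from arg_cong[OF this, of "\<lambda>M. M $ Inl 2 $ Inl 2"]
  have kk: "of_int d = (k ** k) $ Inl 2 $ Inl 2 + real N * (k ** X + X ** K) $ Inl 2 $ Inl 2"
    by (simp add: KK mat_def)
  \<comment> \<open>Column \<open>Inl 2\<close> of \<open>k\<close> vanishes off the diagonal, so a
    single summand remains.\<close>
  have "(k ** k) $ Inl 2 $ Inl 2 = k $ Inl 2 $ Inl 2 * k $ Inl 2 $ Inl 2"
    unfolding matrix_matrix_mult_def by (simp, rule sum_single_nonzero) (simp add: col)
  moreover have "integral_mat (k ** X + X ** K)" by (intro integral_mat_intros ki Xi Ki)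
  then obtain q where "(k ** X + X ** K) $ Inl 2 $ Inl 2 = of_int q"
    unfolding integral_mat_def by (metis Ints_cases)
  ultimately have "of_int d = (of_int (l\<^sup>2 + int N * q) :: real)"
    using kk by (simp add: l power2_eq_square)
  then have "d = l\<^sup>2 + int N * q" by (simp only: of_int_eq_iff)
  then have dvd2: "int N dvd l\<^sup>2 - d" by simp
  show thesis using that lm dvd1 dvd2 .
qed

section \<open>Exclusion of real points\<close>

text \<open>This places each point in its own orbit, so that stability of an orbit under the
  involution can be tested on a representative.\<close>

lemma mat_1_mem_Gamma_hat: "d \<noteq> 0 \<Longrightarrow> mat 1 \<in> Gamma_hat d N"
proof -
  assume d: "d \<noteq> 0"
  have "mat 1 \<in> Sp4R"
    unfolding Sp4R_def symmetric_mat_def mem_Collect_eq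
    by (rule exI[of _ "mat 1"], rule exI[of _ 0], rule exI[of _ 0], rule exI[of _ "mat 1"])
      (simp add: block_1 transpose_mat transpose_0)
  then have g: "mat 1 \<in> Gamma_principal N"
    by (auto simp: Gamma_principal_def Sp4Z_def mat_def intro: exI[of _ 0])
  have "hat_Sp d (mat 1) = mat 1"
    using d by (simp add: hat_Sp_def matrix_inv_both invertible_N_beta)
  then show ?thesis using g unfolding Gamma_hat_def by (metis IntI image_eqI)
qed

lemma plane_act_1: "plane_act (mat 1) L = L"
  by (simp add: plane_act_def mat_of_real_1)

theorem theorem8p1:
  fixes d :: int and N :: nat
  assumes "d < 0" and "squarefree d"
    and "principal_domain (quadratic_integers d)"
    and "N \<ge> 1"
    and "d mod 4 = 1 \<Longrightarrow> 4 dvd N"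
    and "d = -2 \<Longrightarrow> even N"
    and "d = -1 \<Longrightarrow> even N \<and> N \<ge> 4"
  shows "real_points d (Gamma_hat d N) \<inter> boundary_stratum_1 (Gamma_hat d N) = {}"
proof (rule equals0I)
  fix c assume c: "c \<in> real_points d (Gamma_hat d N) \<inter> boundary_stratum_1 (Gamma_hat d N)"
  have d0: "d \<noteq> 0" using assms(1) by simp
  obtain g z where g: "g \<in> Sp4Z" and z: "Im z > 0"
    and orb: "c = orbit (Gamma_hat d N) (plane_act g (F1_point z))"
    using c unfolding boundary_stratum_1_def boundary_components_1_def by blast
  have "plane_act (mat 1) (plane_act g (F1_point z)) \<in> c"
    unfolding orb orbit_def using mat_1_mem_Gamma_hat[OF d0] by blast
  moreover have "hat_plane d ` c = c" using c unfolding real_points_def by blast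
  ultimately have "hat_plane d (plane_act g (F1_point z)) \<in> c"
    unfolding plane_act_1 by blast
  then obtain \<gamma> where "\<gamma> \<in> Gamma_principal N"
    "hat_plane d (plane_act g (F1_point z)) = plane_act \<gamma> (plane_act g (F1_point z))"
    unfolding orb orbit_def Gamma_hat_def by blast
  then obtain l m :: int
    where lm: "l * m = d" and tr: "int N dvd l + m" and sq: "int N dvd l\<^sup>2 - d"
    using real_boundary_point_eigenvalues[OF d0 _ g z] by metis
  consider "d mod 4 = 1" | "d = -2" | "d = -1"
    using principal_quadratic_integers_discriminant[OF assms(1-3)] by blast
  then show False
  proof cases
    case 1
    \<comment> \<open>Modulo 4, \<open>m\<close> is \<open>- l\<close>, so \<open>d = l m\<close>
      becomes \<open>- l^2\<close>, which is 0 or 3 and never 1.\<close>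
    then have "int 4 dvd int N" using assms(5) by (simp only: int_dvd_int_iff)
    then have "4 dvd l + m" using tr by (metis dvd_trans of_nat_numeral)
    then have m: "m mod 4 = (- l) mod 4" by (simp add: mod_eq_dvd_iff add.commute)
    have "(l * m) mod 4 = (l * (- l)) mod 4" using m by (metis mod_mult_right_eq)
    then have "(- (l * l)) mod 4 = 1" using 1 lm by simp
    moreover have "(l * l) mod 4 = ((l mod 4) * (l mod 4)) mod 4" by (simp add: mod_mult_eq)
    moreover have "l mod 4 \<in> {0, 1, 2, 3}" by auto
    ultimately show False by auto presburger+
  next
    case 2
    \<comment> \<open>An even sum and an even product force \<open>l\<close> and \<open>m\<close>
      both to be even, which would make -2 divisible by 4.\<close>
    then have "even (int N)" using assms(6) by simp
    then have "even (l + m)" using tr by (rule dvd_trans)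
    moreover have "even (l * m)" using lm 2 by simp
    ultimately have "even l" "even m" by auto
    then have "2 * 2 dvd l * m" by (rule mult_dvd_mono)
    then show False using lm 2 by simp
  next
    case 3
    \<comment> \<open>Here \<open>l\<close> is a unit, so \<open>l^2 - d = 2\<close>, and
      \<open>N\<close> would have to divide 2.\<close>
    then have "l dvd 1" using lm by (metis dvd_minus_iff dvd_triv_left)
    then have "l\<^sup>2 = 1" by (auto simp: power2_eq_1_iff)
    then have "int N dvd 2" using sq 3 by simp
    then have "int N \<le> 2" by (rule zdvd_imp_le) simp
    then show False using assms(7) 3 by simp
  qed
qed

end
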